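(* Let $\gamma>1$, $\rho_\ell,\rho_r,p_\ell,p_r>0$ and $u_\ell,u_r\in\mathbb{R}$, put $a_s=\sqrt{\gamma p_s/\rho_s}$ for $s\in\{\ell,r\}$, and suppose $u_r-u_\ell<\frac{2}{\gamma-1}(a_\ell+a_r)$. Let $\phi$ be the associated pressure function for the Riemann problem of the Euler equations, let $p_*>0$ be its unique root in $(0,\infty)$, and let $p_{\min}=\min(p_\ell,p_r)$. Suppose $p_{\min}\le p_*$. For any $p^{[0]}>0$ set $$\tilde p^{[0]}:=\max\left(p_{\min},\;p^{[0]}-\frac{\phi(p^{[0]})}{\phi'(p^{[0]})}\right).$$ Then Newton's method for $\phi$ started from $\tilde p^{[0]}$ (that is, $\tilde p^{[k+1]}=\tilde p^{[k]}-\phi(\tilde p^{[k]})/\phi'(\tilde p^{[k]})$ for $k\ge0$) has all iterates positive and converges to $p_*$.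
   Context: For $p>0$ the pressure function is $\phi(p)=f_\ell(p)+f_r(p)+u_r-u_\ell$, where, for $s\in\{\ell,r\}$, $$f_s(p)=\begin{cases}(p-p_s)\left[\dfrac{C_s}{p+B_s}\right]^{1/2} & \text{if } p>p_s,\\[8pt] \dfrac{2a_s}{\gamma-1}\left[\left(\dfrac{p}{p_s}\right)^{\frac{\gamma-1}{2\gamma}}-1\right] & \text{if } p\le p_s,\end{cases}\qquad C_s=\frac{2}{(\gamma+1)\rho_s},\quad B_s=\frac{\gamma-1}{\gamma+1}\,p_s.$$ The condition $u_r-u_\ell<\frac{2}{\gamma-1}(a_\ell+a_r)$ says that no vacuum occurs; under it $\phi$ has exactly one root $p_*$ in $(0,\infty)$, which is the pressure of the intermediate states in the exact solution of the Riemann problem for the one-dimensional Euler equations of an ideal gas with heat capacity ratio $\gamma$, left state $(\rho_\ell,u_\ell,p_\ell)$ and right state $(\rho_r,u_r,p_r)$. The iteration described in the claim is called the positive Newton method. *)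

theory Defs
  imports "HOL-Analysis.Analysis"
begin

definition sound_speed :: "real \<Rightarrow> real \<Rightarrow> real \<Rightarrow> real" where
  "sound_speed \<gamma> \<rho> p = sqrt (\<gamma> * p / \<rho>)"

text \<open>
  \<open>wave_curve \<gamma> \<rho>s ps\<close> is the function $f_s$ for the side with density \<open>\<rho>s\<close> and pressure \<open>ps\<close>:
  the shock branch for \<open>p > ps\<close> and the rarefaction branch for \<open>p \<le> ps\<close>.
  It is meaningful for \<open>p > 0\<close> only.
\<close>

definition wave_curve :: "real \<Rightarrow> real \<Rightarrow> real \<Rightarrow> real \<Rightarrow> real" where
  "wave_curve \<gamma> \<rho>s ps p =
    (let C = 2 / ((\<gamma> + 1) * \<rho>s);
         B = (\<gamma> - 1) / (\<gamma> + 1) * ps;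
         a = sound_speed \<gamma> \<rho>s ps
     in if p > ps then (p - ps) * sqrt (C / (p + B))
        else 2 * a / (\<gamma> - 1) * ((p / ps) powr ((\<gamma> - 1) / (2 * \<gamma>)) - 1))"

definition pressure_fun ::
  "real \<Rightarrow> real \<Rightarrow> real \<Rightarrow> real \<Rightarrow> real \<Rightarrow> real \<Rightarrow> real \<Rightarrow> real \<Rightarrow> real" where
  "pressure_fun \<gamma> \<rho>l ul pl \<rho>r ur pr p =
    wave_curve \<gamma> \<rho>l pl p + wave_curve \<gamma> \<rho>r pr p + ur - ul"

text \<open>
  The description below denotes the root of the pressure function in $(0,\infty)$, which exists and
  is unique exactly when no vacuum occurs; otherwise its value is unspecified.
\<close>

definition star_pressure ::
  "real \<Rightarrow> real \<Rightarrow> real \<Rightarrow> real \<Rightarrow> real \<Rightarrow> real \<Rightarrow> real \<Rightarrow> real" where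
  "star_pressure \<gamma> \<rho>l ul pl \<rho>r ur pr =
    (THE p. 0 < p \<and> pressure_fun \<gamma> \<rho>l ul pl \<rho>r ur pr p = 0)"

definition newton_step :: "(real \<Rightarrow> real) \<Rightarrow> real \<Rightarrow> real" where
  "newton_step f x = x - f x / deriv f x"

definition newton_iterate :: "(real \<Rightarrow> real) \<Rightarrow> real \<Rightarrow> nat \<Rightarrow> real" where
  "newton_iterate f x0 k = (newton_step f ^^ k) x0"

end

theory Submission
  imports Defs "HOL-Real_Asymp.Real_Asymp"
begin

text \<open>
  Each wave curve is differentiable on $(0,\infty)$, also where its branches meet, with a positive
  decreasing derivative; so \<open>\<phi>\<close> is increasing and concave. By concavity a Newton step from any point
  does not overshoot the root, and to the left of the root Newton's method increases monotonically.
  The limit is a root because the increments bound \<open>-\<phi>\<close> up to the factor \<open>\<phi>'\<close>, which is largest at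
  the starting point.
\<close>

section \<open>Newton's method for increasing concave functions\<close>

text \<open>The mean value theorem replaces the difference quotient by \<open>f'\<close> at an
  intermediate point, to be compared with \<open>f' x\<close>. Concavity enters through an antitone
  \<open>f'\<close>, so second derivatives never have to be examined where two branches
  meet.\<close>

lemma tangent_above_antimono_deriv:
  fixes f f' :: "real \<Rightarrow> real"
  assumes deriv: "\<And>x. a < x \<Longrightarrow> (f has_real_derivative f' x) (at x)"
    and anti: "\<And>x y. a < x \<Longrightarrow> x \<le> y \<Longrightarrow> f' y \<le> f' x"
    and "a < x" "a < y"
  shows "f y \<le> f x + f' x * (y - x)"
proof (cases x y rule: linorder_cases)
  case less
  then obtain z where z: "x < z" "f y - f x = (y - x) * f' z"
    using MVT2[of x y f f'] deriv \<open>a < x\<close> by force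
  have "(y - x) * f' z \<le> (y - x) * f' x"
    using anti[of x z] z less \<open>a < x\<close> by (intro mult_left_mono) auto
  with z show ?thesis by (simp add: algebra_simps)
next
  case greater
  then obtain z where z: "y < z" "z < x" "f x - f y = (x - y) * f' z"
    using MVT2[of y x f f'] deriv \<open>a < y\<close> by force
  have "(x - y) * f' x \<le> (x - y) * f' z"
    using anti[of z x] z greater \<open>a < y\<close> by (intro mult_left_mono) auto
  with z show ?thesis by (simp add: algebra_simps)
qed simp

lemma strict_mono_pos_deriv:
  fixes f f' :: "real \<Rightarrow> real"
  assumes "\<And>x. a < x \<Longrightarrow> (f has_real_derivative f' x) (at x)"
    and "\<And>x. a < x \<Longrightarrow> 0 < f' x"
    and "a < x" "x < y"
  shows "f x < f y"
proof (rule DERIV_pos_imp_increasing[OF assms(4)])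
  show "\<exists>d. (f has_real_derivative d) (at z) \<and> d > 0" if "x \<le> z" for z
    using assms(1,2)[of z] \<open>a < x\<close> that by auto
qed

text \<open>The tangent at \<open>x\<close> lies above \<open>f\<close>, so it is nonnegative at
  \<open>r\<close>; as it has positive slope, its zero is at most \<open>r\<close>. This covers
  starting points on both sides of the root.\<close>

lemma newton_step_le_root:
  fixes f f' :: "real \<Rightarrow> real"
  assumes deriv: "\<And>x. a < x \<Longrightarrow> (f has_real_derivative f' x) (at x)"
    and pos: "\<And>x. a < x \<Longrightarrow> 0 < f' x"
    and anti: "\<And>x y. a < x \<Longrightarrow> x \<le> y \<Longrightarrow> f' y \<le> f' x"
    and root: "a < r" "f r = 0"
    and x: "a < x"
  shows "newton_step f x \<le> r"
proof -
  have "0 \<le> f x + f' x * (r - x)"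
    using tangent_above_antimono_deriv[of a f f' x r] deriv anti root x by simp
  then have "- f x / f' x \<le> r - x"
    using pos[OF x] by (simp add: field_simps)
  then show ?thesis
    using DERIV_imp_deriv[OF deriv[OF x]] by (simp add: newton_step_def)
qed

text \<open>The iterates increase and are bounded by \<open>r\<close>. The lower bound
  \<open>x0\<close> is part of the conclusion because it later yields positivity.\<close>

lemma newton_iterate_converges:
  fixes f f' :: "real \<Rightarrow> real"
  assumes deriv: "\<And>x. a < x \<Longrightarrow> (f has_real_derivative f' x) (at x)"
    and pos: "\<And>x. a < x \<Longrightarrow> 0 < f' x"
    and anti: "\<And>x y. a < x \<Longrightarrow> x \<le> y \<Longrightarrow> f' y \<le> f' x"
    and root: "f r = 0"
    and x0: "a < x0" "x0 \<le> r"
  shows "(\<forall>k. x0 \<le> newton_iterate f x0 k) \<and> newton_iterate f x0 \<longlonglongrightarrow> r"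
proof -
  note mono = strict_mono_pos_deriv[of a f f', OF deriv pos]
  let ?x = "newton_iterate f x0"
  have step: "?x (Suc k) = newton_step f (?x k)" for k
    by (simp add: newton_iterate_def)
  have nonpos: "f y \<le> 0" if "a < y" "y \<le> r" for y
    using mono[of y r] that root by (cases "y = r") auto
  have increase: "y \<le> newton_step f y" if "a < y" "y \<le> r" for y
    using nonpos[OF that] pos[of y] DERIV_imp_deriv[OF deriv[of y]] that
    by (simp add: newton_step_def divide_nonpos_pos)
  have range: "x0 \<le> ?x k \<and> ?x k \<le> r" for k
  proof (induction k)
    case 0
    then show ?case using x0 by (simp add: newton_iterate_def)
  next
    case (Suc k)
    then show ?case
      using increase[of "?x k"] newton_step_le_root[of a f f' r "?x k"] deriv pos anti root x0
      by (simp add: step)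
  qed
  have "incseq ?x"
    using increase range x0 by (intro incseq_SucI) (metis step less_le_trans)
  then obtain L where L: "?x \<longlonglongrightarrow> L"
    using incseq_convergent[of ?x r] range by blast
  have "x0 \<le> L" "L \<le> r"
    using L range by (auto intro: LIMSEQ_le_const LIMSEQ_le_const2)
  have "a < L" using \<open>x0 \<le> L\<close> x0 by simp
  \<comment> \<open>The constant factor \<open>f' x0\<close> lets the limit be taken without
    continuity of \<open>f'\<close>.\<close>
  have bound: "- f (?x k) \<le> f' x0 * (?x (Suc k) - ?x k)" for k
  proof -
    have gt: "a < ?x k" using range[of k] x0 by simp
    have "- f (?x k) = f' (?x k) * (?x (Suc k) - ?x k)"
      using pos[OF gt] DERIV_imp_deriv[OF deriv[OF gt]] by (simp add: step newton_step_def)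
    also have "\<dots> \<le> f' x0 * (?x (Suc k) - ?x k)"
      using anti[of x0 "?x k"] range[of k] x0 increase[of "?x k"] gt
      by (intro mult_right_mono) (auto simp: step)
    finally show ?thesis .
  qed
  have lim_f: "(\<lambda>k. f (?x k)) \<longlonglongrightarrow> f L"
    using isCont_tendsto_compose[OF DERIV_isCont[OF deriv[OF \<open>a < L\<close>]] L] .
  have lim_increment: "(\<lambda>k. f' x0 * (?x (Suc k) - ?x k)) \<longlonglongrightarrow> f' x0 * (L - L)"
    by (intro tendsto_intros LIMSEQ_Suc L)
  \<comment> \<open>The right-hand side is 0, so \<open>f L\<close> is nonnegative, whereas
    \<open>L < r\<close> would make it negative.\<close>
  have "- f L \<le> f' x0 * (L - L)"
    using LIMSEQ_le[OF tendsto_minus[OF lim_f] lim_increment] bound by blast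
  then have "L = r"
    using mono[of L r] \<open>a < L\<close> \<open>L \<le> r\<close> root by fastforce
  with L range show ?thesis by blast
qed

section \<open>The wave curves\<close>

text \<open>The shock factor is \<open>1 - (p - ps) / (2 * (p + B))\<close> rewritten so that it is
  visibly positive and decreasing in \<open>p\<close>.\<close>

definition wave_slope :: "real \<Rightarrow> real \<Rightarrow> real \<Rightarrow> real \<Rightarrow> real" where
  "wave_slope \<gamma> \<rho> ps p =
    (let C = 2 / ((\<gamma> + 1) * \<rho>);
         B = (\<gamma> - 1) / (\<gamma> + 1) * ps
     in if p > ps then sqrt (C / (p + B)) * ((1 + (ps + B) / (p + B)) / 2)
        else sound_speed \<gamma> \<rho> ps / (\<gamma> * ps) * (p / ps) powr ((\<gamma> - 1) / (2 * \<gamma>) - 1))"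

context
  fixes \<gamma> \<rho> ps :: real
  assumes gamma: "\<gamma> > 1" and rho: "\<rho> > 0" and ps: "ps > 0"
begin

private definition "C = 2 / ((\<gamma> + 1) * \<rho>)"
private definition "B = (\<gamma> - 1) / (\<gamma> + 1) * ps"
private definition "\<kappa> = (\<gamma> - 1) / (2 * \<gamma>)"
private definition "c = sound_speed \<gamma> \<rho> ps"
private definition "shock p = (p - ps) * sqrt (C / (p + B))"
private definition "shock' p = sqrt (C / (p + B)) * ((1 + (ps + B) / (p + B)) / 2)"
private definition "rare p = 2 * c / (\<gamma> - 1) * ((p / ps) powr \<kappa> - 1)"
private definition "rare' p = c / (\<gamma> * ps) * (p / ps) powr (\<kappa> - 1)"

private lemma param_bounds: "C > 0" "B > 0" "0 < \<kappa>" "\<kappa> < 1" "c > 0"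
  using gamma rho ps
  by (simp_all add: C_def B_def \<kappa>_def c_def sound_speed_def divide_less_eq)

private lemma wave_curve_branches:
  "wave_curve \<gamma> \<rho> ps p = (if p > ps then shock p else rare p)"
  by (simp add: wave_curve_def shock_def rare_def C_def B_def \<kappa>_def c_def Let_def)

private lemma wave_slope_branches:
  "wave_slope \<gamma> \<rho> ps p = (if p > ps then shock' p else rare' p)"
  by (simp add: wave_slope_def shock'_def rare'_def C_def B_def \<kappa>_def c_def Let_def)

text \<open>At \<open>ps\<close> the second factor of each slope is 1, and both first factors equal
  \<open>c / (\<gamma> * ps)\<close>. This makes the curve differentiable at \<open>ps\<close> and
  its slope antitone across \<open>ps\<close>.\<close>

private lemma slopes_match: "shock' ps = rare' ps"
proof -
  have sum: "ps + B = 2 * \<gamma> * ps / (\<gamma> + 1)"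
    using gamma by (simp add: B_def field_simps)
  have "C / (ps + B) = \<gamma> * ps / \<rho> / (\<gamma> * ps)\<^sup>2"
    unfolding sum C_def using gamma rho ps by (simp add: divide_simps power2_eq_square)
  then have "sqrt (C / (ps + B)) = c / (\<gamma> * ps)"
    using gamma ps by (simp add: c_def sound_speed_def real_sqrt_divide real_sqrt_mult)
  then show ?thesis
    using param_bounds ps by (simp add: shock'_def rare'_def)
qed

private lemma shock_deriv:
  assumes "p \<ge> ps"
  shows "(shock has_real_derivative shock' p) (at p)"
proof -
  have p: "p + B > 0" using assms ps param_bounds by simp
  have r: "sqrt (p + B) > 0" using p by simp
  have deriv: "((\<lambda>p. (p - ps) * (sqrt C / sqrt (p + B))) has_real_derivative
      sqrt C / sqrt (p + B) + (p - ps) * (- (sqrt C * (inverse (sqrt (p + B)) / 2)) / (p + B))) (at p)"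
    by (rule derivative_eq_intros refl | use p in simp)+
  \<comment> \<open>To be read with \<open>s = sqrt (p + B)\<close>, \<open>t = p + B\<close> and
    \<open>m = ps + B\<close>, so that \<open>t - m = p - ps\<close>.\<close>
  have "K / s + (t - m) * (- (K * (inverse s / 2)) / t) = K / s * ((1 + m / t) / 2)"
    if "s > 0" "t > 0" for K s t m :: real
    using that by (simp add: field_simps)
  from this[OF r p, of "sqrt C" "ps + B"]
  have "sqrt C / sqrt (p + B) + (p - ps) * (- (sqrt C * (inverse (sqrt (p + B)) / 2)) / (p + B))
      = shock' p"
    by (simp add: shock'_def real_sqrt_divide)
  with deriv show ?thesis
    by (simp add: shock_def[abs_def] real_sqrt_divide)
qed

private lemma rare_deriv:
  assumes "p > 0"
  shows "(rare has_real_derivative rare' p) (at p)"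
proof -
  \<comment> \<open>The constants collapse because
    \<open>2 * \<kappa> / (\<gamma> - 1) = 1 / \<gamma>\<close>.\<close>
  have "2 * c / (\<gamma> - 1) * (\<kappa> * (p / ps) powr (\<kappa> - 1) * (1 / ps)) = rare' p"
    using gamma ps by (simp add: rare'_def \<kappa>_def divide_simps)
  moreover have "(rare has_real_derivative
      2 * c / (\<gamma> - 1) * (\<kappa> * (p / ps) powr (\<kappa> - 1) * (1 / ps))) (at p)"
    unfolding rare_def[abs_def] using assms ps gamma
    by (auto intro!: derivative_eq_intros simp: ac_simps)
  ultimately show ?thesis by simp
qed

text \<open>Away from \<open>ps\<close> the curve agrees with a single branch on an open set. At
  \<open>ps\<close> the two one-sided derivatives coincide, and the two half-lines cover the real
  line.\<close>

lemma wave_curve_deriv: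
  assumes "p > 0"
  shows "(wave_curve \<gamma> \<rho> ps has_real_derivative wave_slope \<gamma> \<rho> ps p) (at p)"
proof (cases p ps rule: linorder_cases)
  case less
  have "(wave_curve \<gamma> \<rho> ps has_real_derivative rare' p) (at p)"
    by (rule has_field_derivative_transform_within_open[OF rare_deriv[OF assms], of "{..<ps}"])
      (use less in \<open>auto simp: wave_curve_branches\<close>)
  then show ?thesis using less by (simp add: wave_slope_branches)
next
  case greater
  have "(wave_curve \<gamma> \<rho> ps has_real_derivative shock' p) (at p)"
    by (rule has_field_derivative_transform_within_open[OF shock_deriv, of _ "{ps<..}"])
      (use greater in \<open>auto simp: wave_curve_branches\<close>)
  then show ?thesis using greater by (simp add: wave_slope_branches)
next
  case equal
  have values_match: "shock ps = rare ps" using ps by (simp add: shock_def rare_def)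
  have "(wave_curve \<gamma> \<rho> ps has_real_derivative rare' ps) (at ps within {..ps})"
    by (rule has_field_derivative_transform_within[OF
          DERIV_subset[OF rare_deriv[OF ps] subset_UNIV], of 1])
      (auto simp: wave_curve_branches)
  \<comment> \<open>At \<open>ps\<close> itself the curve takes the rarefaction value, so agreement
    with \<open>shock\<close> on the closed half-line rests on \<open>values_match\<close>.\<close>
  moreover have "(wave_curve \<gamma> \<rho> ps has_real_derivative rare' ps) (at ps within {ps..})"
    by (rule has_field_derivative_transform_within[OF
          DERIV_subset[OF shock_deriv[OF order_refl, unfolded slopes_match] subset_UNIV], of 1])
      (auto simp: wave_curve_branches values_match)
  ultimately have "(wave_curve \<gamma> \<rho> ps has_real_derivative rare' ps) (at ps within {..ps} \<union> {ps..})"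
    unfolding has_field_derivative_iff by (rule Lim_Un)
  moreover have "{..ps} \<union> {ps..} = UNIV" by auto
  ultimately show ?thesis using equal by (simp add: wave_slope_branches)
qed

lemma wave_slope_pos: "p > 0 \<Longrightarrow> wave_slope \<gamma> \<rho> ps p > 0"
  using param_bounds gamma ps
  by (auto simp: wave_slope_branches shock'_def rare'_def intro!: mult_pos_pos divide_pos_pos add_pos_pos)

private lemma shock'_antimono:
  assumes "ps \<le> p" "p \<le> q"
  shows "shock' q \<le> shock' p"
  unfolding shock'_def
proof (intro mult_mono)
  show "sqrt (C / (q + B)) \<le> sqrt (C / (p + B))"
    using assms param_bounds ps by (intro real_sqrt_le_mono divide_left_mono) auto
  have "(ps + B) / (q + B) \<le> (ps + B) / (p + B)"
    using assms param_bounds ps by (intro divide_left_mono) auto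
  then show "(1 + (ps + B) / (q + B)) / 2 \<le> (1 + (ps + B) / (p + B)) / 2"
    by (intro divide_right_mono add_left_mono) auto
qed (use assms param_bounds ps in auto)

private lemma rare'_antimono:
  assumes "0 < p" "p \<le> q"
  shows "rare' q \<le> rare' p"
  unfolding rare'_def using assms param_bounds ps gamma
  by (intro mult_left_mono powr_mono2') (auto simp: divide_right_mono)

text \<open>If \<open>ps\<close> separates the points, the comparison passes through it:
  \<open>shock' q \<le> shock' ps = rare' ps \<le> rare' p\<close>.\<close>

lemma wave_slope_antimono:
  assumes "0 < p" "p \<le> q"
  shows "wave_slope \<gamma> \<rho> ps q \<le> wave_slope \<gamma> \<rho> ps p"
  using assms shock'_antimono[of p q] rare'_antimono[of p q]
    shock'_antimono[of ps q] rare'_antimono[of p ps] slopes_match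
  by (auto simp: wave_slope_branches)

text \<open>The power vanishes since \<open>\<kappa> > 0\<close>. The limit is the term that the
  vacuum condition contains for this side.\<close>

lemma wave_curve_at_right_0:
  "(wave_curve \<gamma> \<rho> ps \<longlongrightarrow> - (2 / (\<gamma> - 1) * sound_speed \<gamma> \<rho> ps)) (at_right 0)"
proof -
  have "((\<lambda>p. (p / ps) powr \<kappa>) \<longlongrightarrow> 0) (at_right 0)"
    using ps param_bounds by real_asymp
  then have "(rare \<longlongrightarrow> 2 * c / (\<gamma> - 1) * (0 - 1)) (at_right 0)"
    unfolding rare_def[abs_def] by (intro tendsto_intros)
  moreover have "\<forall>\<^sub>F p in at_right 0. rare p = wave_curve \<gamma> \<rho> ps p"
    using eventually_at_right_less[of "0::real"] eventually_at_right_real[OF ps]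
    by eventually_elim (simp add: wave_curve_branches)
  ultimately show ?thesis
    by (simp add: c_def tendsto_cong)
qed

text \<open>The shock branch grows like \<open>sqrt p\<close>; this supplies the positive value
  needed for the existence of a root.\<close>

lemma wave_curve_at_top: "filterlim (wave_curve \<gamma> \<rho> ps) at_top at_top"
proof -
  have "filterlim shock at_top at_top"
    unfolding shock_def[abs_def] using param_bounds by real_asymp
  moreover have eq: "\<forall>\<^sub>F p in at_top. shock p = wave_curve \<gamma> \<rho> ps p"
    using eventually_gt_at_top[of ps] by eventually_elim (simp add: wave_curve_branches)
  ultimately show ?thesis
    using filterlim_cong[OF refl refl eq] by blast
qed

end

section \<open>The pressure function\<close>

theorem mainTheorem5:
  fixes \<gamma> \<rho>l ul pl \<rho>r ur pr p0 :: real
  defines "\<phi> \<equiv> pressure_fun \<gamma> \<rho>l ul pl \<rho>r ur pr"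
    and "pstar \<equiv> star_pressure \<gamma> \<rho>l ul pl \<rho>r ur pr"
    and "pmin \<equiv> min pl pr"
  assumes "\<gamma> > 1"
    and "\<rho>l > 0" and "\<rho>r > 0" and "pl > 0" and "pr > 0"
    and no_vacuum: "ur - ul < 2 / (\<gamma> - 1) * (sound_speed \<gamma> \<rho>l pl + sound_speed \<gamma> \<rho>r pr)"
    and "pmin \<le> pstar"
    and "p0 > 0"
  defines "q0 \<equiv> max pmin (p0 - \<phi> p0 / deriv \<phi> p0)"
  shows "(\<forall>k. newton_iterate \<phi> q0 k > 0) \<and> newton_iterate \<phi> q0 \<longlonglongrightarrow> pstar"
proof -
  note left = \<open>\<gamma> > 1\<close> \<open>\<rho>l > 0\<close> \<open>pl > 0\<close> and right = \<open>\<gamma> > 1\<close> \<open>\<rho>r > 0\<close> \<open>pr > 0\<close>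
  define \<phi>' where "\<phi>' p = wave_slope \<gamma> \<rho>l pl p + wave_slope \<gamma> \<rho>r pr p" for p
  \<comment> \<open>The constant stands first to fit the limit rule for a convergent plus a
    divergent summand.\<close>
  have \<phi>_eq: "\<phi> = (\<lambda>p. (ur - ul) + (wave_curve \<gamma> \<rho>l pl p + wave_curve \<gamma> \<rho>r pr p))"
    by (simp add: \<phi>_def pressure_fun_def fun_eq_iff)
  have deriv: "(\<phi> has_real_derivative \<phi>' p) (at p)" if "0 < p" for p
    unfolding \<phi>_eq \<phi>'_def
    using wave_curve_deriv[OF left that] wave_curve_deriv[OF right that]
    by (auto intro!: derivative_eq_intros)
  have pos: "0 < \<phi>' p" if "0 < p" for p
    using wave_slope_pos[OF left that] wave_slope_pos[OF right that] by (simp add: \<phi>'_def)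
  have anti: "\<phi>' q \<le> \<phi>' p" if "0 < p" "p \<le> q" for p q
    using wave_slope_antimono[OF left that] wave_slope_antimono[OF right that]
    by (simp add: \<phi>'_def)
  note mono = strict_mono_pos_deriv[of 0 \<phi> \<phi>', OF deriv pos]

  have "(\<phi> \<longlongrightarrow> (ur - ul) + (- (2 / (\<gamma> - 1) * sound_speed \<gamma> \<rho>l pl)
      + - (2 / (\<gamma> - 1) * sound_speed \<gamma> \<rho>r pr))) (at_right 0)"
    unfolding \<phi>_eq by (intro tendsto_intros wave_curve_at_right_0 left right)
  \<comment> \<open>By \<open>no_vacuum\<close> the limit at 0 is negative.\<close>
  then have "\<forall>\<^sub>F p in at_right 0. \<phi> p < 0"
    using no_vacuum by (intro order_tendstoD(2)[where a = 0]) (auto simp: algebra_simps)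
  then obtain x where x: "0 < x" "\<phi> x < 0"
    using eventually_happens[OF eventually_conj[OF eventually_at_right_less[of "0::real"]]]
    by (auto simp: trivial_limit_at_right_real)
  have "filterlim \<phi> at_top at_top"
    unfolding \<phi>_eq
    by (intro filterlim_tendsto_add_at_top[OF tendsto_const] filterlim_at_top_add_at_top
        wave_curve_at_top left right)
  then have "\<forall>\<^sub>F p in at_top. x < p \<and> 0 < \<phi> p"
    using eventually_gt_at_top[of x] by (intro eventually_conj) (auto simp: filterlim_at_top_dense)
  then obtain y where y: "x < y" "0 < \<phi> y"
    by (auto simp: eventually_at_top_linorder)
  have "\<forall>z. x \<le> z \<and> z \<le> y \<longrightarrow> isCont \<phi> z"
    using x DERIV_isCont[OF deriv] by auto
  then obtain r where "x \<le> r" "\<phi> r = 0"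
    using IVT[of \<phi> x 0 y] x y by auto
  with x have r: "0 < r" "\<phi> r = 0" by auto
  have "pstar = r"
    unfolding pstar_def star_pressure_def \<phi>_def[symmetric]
  proof (rule the_equality)
    show "p = r" if "0 < p \<and> \<phi> p = 0" for p
      using that r mono[of p r] mono[of r p] by (cases p r rule: linorder_cases) auto
  qed (use r in auto)

  have "0 < pmin" by (simp add: pmin_def left right)
  have "newton_step \<phi> p0 \<le> r"
    using newton_step_le_root[of 0 \<phi> \<phi>' r p0] deriv pos anti r \<open>p0 > 0\<close> by blast
  \<comment> \<open>The cut-off at \<open>pmin\<close> keeps \<open>q0\<close> positive even if the
    raw Newton step is not. Both arguments of the maximum are at most \<open>r\<close>: one by
    hypothesis, the other by concavity.\<close>
  then have "0 < q0" "q0 \<le> r"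
    using \<open>0 < pmin\<close> \<open>pmin \<le> pstar\<close> \<open>pstar = r\<close> by (auto simp: q0_def newton_step_def)
  then have "(\<forall>k. q0 \<le> newton_iterate \<phi> q0 k) \<and> newton_iterate \<phi> q0 \<longlonglongrightarrow> r"
    using newton_iterate_converges[of 0 \<phi> \<phi>' r q0] deriv pos anti r by blast
  with \<open>0 < q0\<close> \<open>pstar = r\<close> show ?thesis
    by (auto intro: less_le_trans)
qed

end
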